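(* Let $K$ be a field of characteristic $0$, let $N\in K[t]$, and let $D=D_1D_2\cdots D_k$ be a factorization of a nonzero polynomial $D$ in $K[t]$ such that $D_1$ is relatively prime to $D_i$ for $i=2,\dots,k$. Suppose that for each $i=2,\dots,k$ polynomials $s_i,r_i\in K[t]$ satisfy $$\frac1{D_1D_i}=\frac{s_i}{D_1}+\frac{r_i}{D_i}$$ (no degree conditions on $s_i,r_i$ are required). Then $$\mathrm{Frac}\Big(\frac{N}{D},D_1\Big)=\mathrm{Frac}\Big(\frac{N\,s_2s_3\cdots s_k}{D_1}\Big).$$
   Context: A rational function $A/B$ ($A,B\in K[t]$, $B\ne 0$) is proper if $\deg A<\deg B$ ($0$ is proper). Every rational function is uniquely a polynomial plus a proper rational function; $\mathrm{Frac}(A/B)$ denotes its proper part. If $D=D_1D'$ with $D_1,D'\in K[t]$ relatively prime, then $N/D$ can be uniquely written as $p+\frac{r_1}{D_1}+\frac{r'}{D'}$ with $p,r_1,r'\in K[t]$, $\deg r_1<\deg D_1$, $\deg r'<\deg D'$; then $\mathrm{Frac}(N/D,D_1)=r_1/D_1$. *)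

theory Defs
  imports "HOL-Computational_Algebra.Computational_Algebra"
begin

text \<open>Rational functions over \<open>K\<close> are elements of \<open>'a poly fract\<close>; \<open>Fract A B\<close> is \<open>A/B\<close>
  (with the junk value \<open>0\<close> if \<open>B = 0\<close>).

  The library has \<open>degree 0 = 0\<close>, so the convention \<open>deg 0 = -\<infinity>\<close> is spelled out here;
  \<open>B\<close> is always nonzero where this is used.\<close>

definition deg_less :: "'a::zero poly \<Rightarrow> 'a poly \<Rightarrow> bool" where
  "deg_less A B \<longleftrightarrow> A = 0 \<or> degree A < degree B"

definition proper_fract :: "'a::field poly fract \<Rightarrow> bool" where
  "proper_fract f \<longleftrightarrow> (\<exists>A B. B \<noteq> 0 \<and> f = Fract A B \<and> deg_less A B)"

definition Frac :: "'a::field poly fract \<Rightarrow> 'a poly fract" where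
  "Frac f = (THE g. proper_fract g \<and> (\<exists>p. f = to_fract p + g))"

text \<open>\<open>Frac_at N D D1\<close> is \<open>Frac(N/D, D1)\<close>. It is meaningful only if \<open>D \<noteq> 0\<close> and
  \<open>D = D1 * D'\<close> with \<open>D1\<close>, \<open>D'\<close> relatively prime (see \<open>Frac_at_eqI\<close> below).\<close>

definition Frac_at :: "'a::field poly \<Rightarrow> 'a poly \<Rightarrow> 'a poly \<Rightarrow> 'a poly fract" where
  "Frac_at N D D1 = (THE g. \<exists>D' p r1 r'.
     D = D1 * D' \<and> coprime D1 D' \<and>
     Fract N D = to_fract p + Fract r1 D1 + Fract r' D' \<and>
     deg_less r1 D1 \<and> deg_less r' D' \<and>
     g = Fract r1 D1)"

text \<open>Both descriptions are well defined.\<close>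

lemma deg_less_dvd_imp_zero:
  fixes A B :: "'a::field poly"
  assumes "B dvd A" "deg_less A B"
  shows "A = 0"
  using assms dvd_imp_degree_le[of B A] unfolding deg_less_def by (metis leD)

lemma deg_less_diff:
  fixes A B C :: "'a::field poly"
  assumes "deg_less A C" "deg_less B C"
  shows "deg_less (A - B) C"
  using assms degree_diff_less[of A "degree C" B] unfolding deg_less_def by auto

lemma deg_less_mod:
  fixes A B :: "'a::field poly"
  assumes "B \<noteq> 0"
  shows "deg_less (A mod B) B"
  using degree_mod_less[OF assms, of A] unfolding deg_less_def by auto

lemma Fract_div_mod:
  fixes A B :: "'a::field poly"
  assumes "B \<noteq> 0"
  shows "Fract A B = to_fract (A div B) + Fract (A mod B) B"
proof -
  have "A = A div B * B + A mod B" by simp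
  then show ?thesis using assms by (simp add: to_fract_def eq_fract)
qed

lemma coprime_poly_bezout:
  fixes p q :: "'a::field poly"
  assumes "coprime p q"
  shows "\<exists>u v. u * p + v * q = 1"
  using assms
proof (induction "if q = 0 then 0 else Suc (degree q)" arbitrary: p q rule: less_induct)
  case less
  show ?case
  proof (cases "q = 0")
    case True
    then have "p dvd 1" using less.prems by simp
    then show ?thesis using True by (metis add_0_right dvdE mult.commute mult_zero_right)
  next
    case False
    have "coprime q (p mod q)"
    proof (rule coprimeI)
      fix c assume "c dvd q" "c dvd p mod q"
      moreover have "p = p div q * q + p mod q" by simp
      ultimately have "c dvd p" by (metis dvd_add dvd_mult)
      then show "is_unit c" using \<open>c dvd q\<close> coprime_common_divisor[OF less.prems] by blast
    qed
    moreover have "(if p mod q = 0 then 0 else Suc (degree (p mod q))) < Suc (degree q)"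
      using degree_mod_less[OF False, of p] by auto
    ultimately obtain u v where uv: "u * q + v * (p mod q) = 1"
      using less.hyps[of "p mod q" q] False by auto
    have "p mod q = p - p div q * q" by (simp add: minus_div_mult_eq_mod)
    with uv have "v * p + (u - v * (p div q)) * q = 1" by (simp add: algebra_simps)
    then show ?thesis by blast
  qed
qed

lemma coprime_poly_dvd_mult:
  fixes a b c :: "'a::field poly"
  assumes "coprime a b" "a dvd c * b"
  shows "a dvd c"
proof -
  obtain u v where uv: "u * a + v * b = 1" using coprime_poly_bezout[OF assms(1)] by blast
  have "c = c * (u * a + v * b)" using uv by simp
  also have "\<dots> = c * u * a + v * (c * b)" by (simp add: algebra_simps)
  finally show ?thesis using assms(2) by (metis dvd_add dvd_mult dvd_triv_right)
qed

lemma Frac_ex1: "\<exists>!g. proper_fract g \<and> (\<exists>p. f = to_fract p + g)"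
proof (rule ex_ex1I)
  obtain A B where "f = Fract A B" "B \<noteq> 0" by (cases f) auto
  then show "\<exists>g. proper_fract g \<and> (\<exists>p. f = to_fract p + g)"
    using Fract_div_mod deg_less_mod unfolding proper_fract_def by metis
next
  fix g h
  assume "proper_fract g \<and> (\<exists>p. f = to_fract p + g)" "proper_fract h \<and> (\<exists>p. f = to_fract p + h)"
  then obtain A B p C E q where
    g: "B \<noteq> 0" "g = Fract A B" "deg_less A B" and
    h: "E \<noteq> 0" "h = Fract C E" "deg_less C E" and
    eq: "to_fract p + g = to_fract q + h"
    unfolding proper_fract_def by metis
  have "(p * B + A) * E = (q * E + C) * B"
    using eq g h by (simp add: to_fract_def eq_fract)
  then have *: "C * B - A * E = (p - q) * (B * E)" by (simp add: algebra_simps)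
  have "deg_less (C * B) (B * E)" "deg_less (A * E) (B * E)"
    using g h by (cases "A = 0"; cases "C = 0"; simp add: deg_less_def degree_mult_eq)+
  then have "C * B - A * E = 0"
    using * deg_less_diff deg_less_dvd_imp_zero by (metis dvd_triv_right)
  then show "g = h" using g h by (simp add: eq_fract)
qed

lemma Frac_at_eqI:
  fixes N D D1 D' p r1 r' :: "'a::field poly"
  assumes "D \<noteq> 0" and D: "D = D1 * D'" and cop: "coprime D1 D'"
    and eq: "Fract N D = to_fract p + Fract r1 D1 + Fract r' D'"
    and deg: "deg_less r1 D1" "deg_less r' D'"
  shows "Frac_at N D D1 = Fract r1 D1"
  unfolding Frac_at_def
proof (rule the_equality)
  show "\<exists>D' p s1 s'. D = D1 * D' \<and> coprime D1 D' \<and>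
     Fract N D = to_fract p + Fract s1 D1 + Fract s' D' \<and>
     deg_less s1 D1 \<and> deg_less s' D' \<and> Fract r1 D1 = Fract s1 D1"
    using assms by blast
next
  fix g
  assume "\<exists>D' p r1 r'. D = D1 * D' \<and> coprime D1 D' \<and>
     Fract N D = to_fract p + Fract r1 D1 + Fract r' D' \<and>
     deg_less r1 D1 \<and> deg_less r' D' \<and> g = Fract r1 D1"
  then obtain E q s1 s' where E: "D = D1 * E"
    "Fract N D = to_fract q + Fract s1 D1 + Fract s' E"
    "deg_less s1 D1" "deg_less s' E" "g = Fract s1 D1" by blast
  have nz: "D1 \<noteq> 0" "D' \<noteq> 0" using assms by auto
  have "E = D'" using E(1) D nz by simp
  then have "to_fract p + Fract r1 D1 + Fract r' D' = to_fract q + Fract s1 D1 + Fract s' D'"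
    using eq E by simp
  then have "(p * D1 + r1) * D' + r' * D1 = (q * D1 + s1) * D' + s' * D1"
    using nz by (simp add: to_fract_def eq_fract)
  then have "(r1 - s1) * D' = D1 * (q * D' + s' - p * D' - r')" by (simp add: algebra_simps)
  then have "D1 dvd (r1 - s1) * D'" by simp
  then have "D1 dvd r1 - s1" by (rule coprime_poly_dvd_mult[OF cop])
  then have "r1 - s1 = 0" using deg_less_diff deg(1) E(3) deg_less_dvd_imp_zero by blast
  then show "g = Fract r1 D1" using E(5) by simp
qed

lemma Frac_at_decomposition_exists:
  fixes N D1 D' :: "'a::field poly"
  assumes "D1 * D' \<noteq> 0" "coprime D1 D'"
  shows "\<exists>p r1 r'. Fract N (D1 * D') = to_fract p + Fract r1 D1 + Fract r' D' \<and>
    deg_less r1 D1 \<and> deg_less r' D'"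
proof -
  have nz: "D1 \<noteq> 0" "D' \<noteq> 0" using assms by auto
  obtain u v where uv: "u * D1 + v * D' = 1" using coprime_poly_bezout[OF assms(2)] by blast
  have "N = N * (u * D1 + v * D')" using uv by simp
  then have "N = N * v * D' + N * u * D1" by (simp add: algebra_simps)
  then have "Fract N (D1 * D') = Fract (N * v) D1 + Fract (N * u) D'"
    using nz by (simp add: eq_fract)
  also have "\<dots> = to_fract (N * v div D1 + N * u div D') +
      Fract (N * v mod D1) D1 + Fract (N * u mod D') D'"
    by (simp only: Fract_div_mod[OF nz(1), of "N * v"] Fract_div_mod[OF nz(2), of "N * u"]
        to_fract_add add_ac)
  finally show ?thesis using nz deg_less_mod by blast
qed

end

theory Submission
  imports Defs
begin

text \<open>The hypotheses say \<open>s i * d i \<equiv> 1\<close> modulo \<open>d 1\<close>, so \<open>S = \<Prod>i=2..k. s i\<close> inverts the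
  cofactor \<open>D' = \<Prod>i=2..k. d i\<close> modulo \<open>d 1\<close>. Any identity \<open>S * D' + v * d 1 = 1\<close> yields
  \<open>N/D = N S / d 1 + N v / D'\<close>, and division with remainder in both terms gives the claim.\<close>

lemma Frac_Fract:
  fixes A B :: "'a::field poly"
  assumes "B \<noteq> 0"
  shows "Frac (Fract A B) = Fract (A mod B) B"
  unfolding Frac_def
proof (rule the1_equality[OF Frac_ex1])
  show "proper_fract (Fract (A mod B) B) \<and> (\<exists>p. Fract A B = to_fract p + Fract (A mod B) B)"
    using Fract_div_mod[OF assms] deg_less_mod[OF assms] assms
    unfolding proper_fract_def by blast
qed

lemma Frac_at_eq_Frac_if_bezout:
  fixes N D1 D' S v :: "'a::field poly"
  assumes nz: "D1 * D' \<noteq> 0" and bezout: "S * D' + v * D1 = 1"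
  shows "Frac_at N (D1 * D') D1 = Frac (Fract (N * S) D1)"
proof -
  have nz1: "D1 \<noteq> 0" and nz': "D' \<noteq> 0" using nz by auto
  \<comment> \<open>A common divisor divides the left side of \<open>bezout\<close>, hence
    1.\<close>
  have coprime: "coprime D1 D'"
    by (rule coprimeI) (metis bezout dvd_add dvd_mult)
  have "N = N * S * D' + N * v * D1"
    using arg_cong[OF bezout, of "(*) N"] by (simp add: algebra_simps)
  then have "Fract N (D1 * D') = Fract (N * S) D1 + Fract (N * v) D'"
    using nz1 nz' by (simp add: eq_fract)
  \<comment> \<open>The two quotients merge into one polynomial part; the remainders meet the degree
    bounds of \<open>Frac_at_eqI\<close>.\<close>
  also have "\<dots> = to_fract (N * S div D1 + N * v div D') +
      Fract (N * S mod D1) D1 + Fract (N * v mod D') D'"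
    by (simp only: Fract_div_mod[OF nz1, of "N * S"] Fract_div_mod[OF nz', of "N * v"]
        to_fract_add add_ac)
  finally have "Frac_at N (D1 * D') D1 = Fract (N * S mod D1) D1"
    by (rule Frac_at_eqI[OF nz refl coprime _ deg_less_mod[OF nz1] deg_less_mod[OF nz']])
  then show ?thesis using Frac_Fract[OF nz1] by simp
qed

text \<open>Congruences \<open>s i * d i \<equiv> 1\<close> modulo \<open>m\<close> multiply;
  \<open>v\<close> is the accumulated cofactor of \<open>m\<close>.\<close>

lemma prod_bezout:
  fixes m :: "'a::comm_ring_1"
  assumes "\<And>i. i \<in> I \<Longrightarrow> s i * d i + r i * m = 1"
  shows "\<exists>v. prod s I * prod d I + v * m = 1"
  using assms
proof (induction I rule: infinite_finite_induct)
  case (insert i I)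
  then obtain v where v: "prod s I * prod d I + v * m = 1" by auto
  have "s i * d i + r i * m = 1" using insert.prems by simp
  then have "s i * d i * (prod s I * prod d I) = (1 - r i * m) * (1 - v * m)"
    using v by (metis add_diff_cancel_right')
  \<comment> \<open>The new cofactor comes from expanding
    \<open>(1 - r i * m) * (1 - v * m)\<close>.\<close>
  then have "prod s (insert i I) * prod d (insert i I) + (r i + v - r i * v * m) * m = 1"
    using insert.hyps by (simp add: algebra_simps)
  then show ?case by blast
\<comment> \<open>For empty or infinite \<open>I\<close> both products are 1, so
  \<open>v = 0\<close> works.\<close>
qed (auto intro: exI[of _ 0])

theorem mainTheorem9:
  fixes N D :: "'a::field_char_0 poly"
    and d s r :: "nat \<Rightarrow> 'a poly"
    and k :: nat
  assumes "k \<ge> 1"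
    and "D \<noteq> 0"
    and "D = (\<Prod>i=1..k. d i)"
    and "\<And>i. i \<in> {2..k} \<Longrightarrow> coprime (d 1) (d i)"
    and "\<And>i. i \<in> {2..k} \<Longrightarrow>
           Fract 1 (d 1 * d i) = Fract (s i) (d 1) + Fract (r i) (d i)"
  shows "Frac_at N D (d 1) = Frac (Fract (N * (\<Prod>i=2..k. s i)) (d 1))"
proof -
  \<comment> \<open>For \<open>k = 1\<close> the cofactor is the empty product 1.\<close>
  have D: "D = d 1 * (\<Prod>i=2..k. d i)"
    using assms(1,3) by (simp add: prod.atLeast_Suc_atMost numeral_2_eq_2)
  have "s i * d i + r i * d 1 = 1" if i: "i \<in> {2..k}" for i
  proof -
    have nz: "d 1 \<noteq> 0" "d i \<noteq> 0" using assms(2) D i by auto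
    \<comment> \<open>Adding over the common denominator and cross-multiplying leaves the nonzero
      factor \<open>d 1 * d i\<close> to cancel.\<close>
    then have "d 1 * d i = (s i * d i + r i * d 1) * (d 1 * d i)"
      using assms(5)[OF i] by (simp add: eq_fract)
    then show ?thesis using nz by simp
  qed
  then obtain v where "(\<Prod>i=2..k. s i) * (\<Prod>i=2..k. d i) + v * d 1 = 1"
    using prod_bezout[of "{2..k}" s d r "d 1"] by blast
  then show ?thesis
    using Frac_at_eq_Frac_if_bezout assms(2) unfolding D by blast
qed

end
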